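(* Let \[ C_{\mathrm{pos}}=\frac{5\cdot 3^{4/5}}{\pi^{7/5}}+\frac{\sqrt2}{\pi^{1/4}}\approx 3.48695 . \] Then for every dimension $d=2^m$ ($m\ge1$ an integer), \[ \sup_{u\in S^{d-1}}\ \sup_{1\le k\le d}\ \mathrm{K}\bigl([T(u)]_k,[X(u)]_k\bigr)\le C_{\mathrm{pos}}\,d^{-1/5}. \]
   Context: $S^{d-1}$ is the unit sphere in $\mathbb{R}^d$. $H$ is the unnormalized $d\times d$ Walsh--Hadamard matrix ($H_1=(1)$, $H_{2n}=\begin{pmatrix}H_n&H_n\\H_n&-H_n\end{pmatrix}$). $D^{(1)},D^{(2)}$ are independent diagonal matrices with i.i.d. Rademacher diagonal entries. For deterministic $u\in S^{d-1}$, $T(u)=\frac1d HD^{(1)}HD^{(2)}u$, and $X(u)=Ru$ where $R$ is Haar-distributed on the orthogonal group $\mathcal O(d)$ (so $X(u)$ is uniform on $S^{d-1}$). $[v]_k$ is the $k$th coordinate. For real random variables $A,B$, $\mathrm{K}(A,B)=\sup_{t\in\mathbb{R}}|\mathbb{P}(A\le t)-\mathbb{P}(B\le t)|$ is the Kolmogorov distance. *)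

theory Defs
  imports "HOL-Probability.Probability"
begin

text \<open>Dimension d = 2^m; vectors are functions nat => real, only indices < d matter;
  indices are 0-based.\<close>

fun hadamard :: "nat \<Rightarrow> nat \<Rightarrow> nat \<Rightarrow> real" where
  "hadamard 0 i j = 1"
| "hadamard (Suc m) i j =
     (if i < 2^m \<and> j < 2^m then hadamard m i j
      else if i < 2^m then hadamard m i (j - 2^m)
      else if j < 2^m then hadamard m (i - 2^m) j
      else - hadamard m (i - 2^m) (j - 2^m))"

definition sign_vectors :: "nat \<Rightarrow> (nat \<Rightarrow> real) set" where
  "sign_vectors d = {0..<d} \<rightarrow>\<^sub>E {-1, 1}"

text \<open>Coordinate k of T(u) = (1/d) H D1 H D2 u, for given diagonals e1, e2.\<close>
definition T_coord :: "nat \<Rightarrow> (nat \<Rightarrow> real) \<Rightarrow> nat \<Rightarrow> (nat \<Rightarrow> real) \<Rightarrow> (nat \<Rightarrow> real) \<Rightarrow> real" where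
  "T_coord m u k e1 e2 = (1 / real (2^m)) *
     (\<Sum>j<2^m. \<Sum>l<2^m. hadamard m k j * e1 j * hadamard m j l * e2 l * u l)"

text \<open>CDF of [T(u)]_k with D1, D2 independent with iid Rademacher entries.\<close>
definition T_cdf :: "nat \<Rightarrow> (nat \<Rightarrow> real) \<Rightarrow> nat \<Rightarrow> real \<Rightarrow> real" where
  "T_cdf m u k t = measure_pmf.prob (pmf_of_set (sign_vectors (2^m) \<times> sign_vectors (2^m)))
      {p. T_coord m u k (fst p) (snd p) \<le> t}"

definition mat_space :: "nat \<Rightarrow> ((nat \<times> nat) \<Rightarrow> real) measure" where
  "mat_space d = PiM ({0..<d} \<times> {0..<d}) (\<lambda>_. borel)"

definition orth_mat :: "nat \<Rightarrow> ((nat \<times> nat) \<Rightarrow> real) \<Rightarrow> bool" where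
  "orth_mat d R \<longleftrightarrow> (\<forall>i<d. \<forall>j<d. (\<Sum>k<d. R (k, i) * R (k, j)) = (if i = j then 1 else 0))"

definition mat_mult :: "nat \<Rightarrow> ((nat \<times> nat) \<Rightarrow> real) \<Rightarrow> ((nat \<times> nat) \<Rightarrow> real) \<Rightarrow> ((nat \<times> nat) \<Rightarrow> real)" where
  "mat_mult d Q R = restrict (\<lambda>(i, j). \<Sum>k<d. Q (i, k) * R (k, j)) ({0..<d} \<times> {0..<d})"

text \<open>Haar probability measure on O(d): a probability measure on d x d matrices,
  concentrated on orthogonal matrices and invariant under left multiplication by
  orthogonal matrices (it exists and is unique).\<close>
definition haar_orth :: "nat \<Rightarrow> ((nat \<times> nat) \<Rightarrow> real) measure \<Rightarrow> bool" where
  "haar_orth d M \<longleftrightarrow> prob_space M \<and> sets M = sets (mat_space d) \<and>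
     (AE R in M. orth_mat d R) \<and>
     (\<forall>Q \<in> space (mat_space d). orth_mat d Q \<longrightarrow> distr M (mat_space d) (mat_mult d Q) = M)"

definition X_cdf :: "nat \<Rightarrow> ((nat \<times> nat) \<Rightarrow> real) measure \<Rightarrow> (nat \<Rightarrow> real) \<Rightarrow> nat \<Rightarrow> real \<Rightarrow> real" where
  "X_cdf d M u k t = measure M {R \<in> space M. (\<Sum>l<d. R (k, l) * u l) \<le> t}"

definition kolmogorov_dist :: "(real \<Rightarrow> real) \<Rightarrow> (real \<Rightarrow> real) \<Rightarrow> real" where
  "kolmogorov_dist F G = (SUP t. \<bar>F t - G t\<bar>)"

definition C_pos :: real where
  "C_pos = 5 * 3 powr (4/5) / pi powr (7/5) + sqrt 2 / pi powr (1/4)"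

end

theory Submission
  imports Defs
begin

text \<open>Both sqrt d [T(u)]_k and sqrt d [X(u)]_k are Rademacher sums with random weight vectors
  of unit norm: for T the signs are the entries of the outer diagonal, and for X left invariance
  of the Haar measure under the orthogonal matrices H D / sqrt d inserts the same signs. In both
  cases the same trick bounds the fourth moment of each weight by 3 / d^2. A fourth order Lindeberg
  replacement then compares smooth test functions of either variable with the standard Gaussian up
  to O(1/d). Sandwiching the indicator of a half line between smooth steps of width
  5 d^(-1/5), and using that the Gaussian density is at most 1 / sqrt (2 pi), gives the rate.\<close>

subsection \<open>Rademacher averages and Hadamard matrices\<close>

text \<open>The exponent comes from a trade-off. A sign and a centred Gaussian of equal variance
  share their moments up to order three, so exchanging them inside a test function costs only the
  fourth power of the weight. With fourth moments at most 3/d^2, the d weights contribute O(1/d) in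
  total. Matching just two moments would leave a cubic error of order d^(-1/2). A step of width
  \<epsilon> has fourth derivative of order \<epsilon>^(-4), so the full error behaves like 1/(d
  \<epsilon>^4) + \<epsilon>, which balances at \<epsilon> of order d^(-1/5).

  \<open>haar_orth\<close> describes the Haar measure by axioms, not by a formula, so even the
  moments of the rotated vector have to be extracted from invariance.

  The numbers leave room: the chosen step has fourth derivative at most 840, which leads to a total
  constant below 3.4, while \<open>C_pos\<close> exceeds 3.4. Crude rational estimates of pi
  therefore suffice at the end.\<close>

definition sign_mean :: "nat \<Rightarrow> ((nat \<Rightarrow> real) \<Rightarrow> real) \<Rightarrow> real" where
  "sign_mean n g = (\<Sum>e\<in>sign_vectors n. g e) / 2 ^ n"

lemma finite_sign_vectors [simp]: "finite (sign_vectors n)"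
  unfolding sign_vectors_def by (intro finite_PiE) auto

lemma card_sign_vectors [simp]: "card (sign_vectors n) = 2 ^ n"
  unfolding sign_vectors_def by (subst card_PiE) (auto simp: card_insert_if numeral_2_eq_2)

lemma sign_vectors_nonempty [simp]: "sign_vectors n \<noteq> {}"
  by (metis card.empty card_sign_vectors power_not_zero zero_neq_numeral)

lemma sign_vectors_square: "e \<in> sign_vectors n \<Longrightarrow> i < n \<Longrightarrow> e i * e i = 1"
  unfolding sign_vectors_def by (force simp: PiE_iff)

text \<open>The extensional function space over the empty index set has exactly one element, the
  function that is \<open>undefined\<close> everywhere.\<close>

lemma sign_mean_0: "sign_mean 0 g = g (\<lambda>_. undefined)"
  by (simp add: sign_mean_def sign_vectors_def)

text \<open>Conditioning on the last sign; every induction over the number of signs goes through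
  this recursion.\<close>

lemma sign_mean_Suc:
  "sign_mean (Suc n) g = sign_mean n (\<lambda>e. (g (e(n := 1)) + g (e(n := -1))) / 2)"
proof -
  have "sum g (sign_vectors (Suc n)) = (\<Sum>(y, e)\<in>{-1, 1} \<times> sign_vectors n. g (e(n := y)))"
    unfolding sign_vectors_def atLeast0_lessThan_Suc PiE_insert_eq
    by (subst sum.reindex[OF inj_combinator]) (auto intro!: sum.cong)
  also have "\<dots> = (\<Sum>e\<in>sign_vectors n. g (e(n := 1)) + g (e(n := -1)))"
    by (subst sum.cartesian_product[symmetric]) (simp add: sum.distrib add.commute)
  finally show ?thesis
    by (simp add: sign_mean_def sum_divide_distrib)
qed

lemma sign_mean_const [simp]: "sign_mean n (\<lambda>_. c) = c"
  by (simp add: sign_mean_def)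

lemma sign_mean_add: "sign_mean n (\<lambda>e. f e + g e) = sign_mean n f + sign_mean n g"
  by (simp add: sign_mean_def sum.distrib add_divide_distrib)

lemma sign_mean_diff: "sign_mean n (\<lambda>e. f e - g e) = sign_mean n f - sign_mean n g"
  by (simp add: sign_mean_def sum_subtractf diff_divide_distrib)

lemma sign_mean_cmult: "sign_mean n (\<lambda>e. c * f e) = c * sign_mean n f"
  by (simp add: sign_mean_def sum_distrib_left)

lemma sign_mean_sum: "sign_mean n (\<lambda>e. \<Sum>i\<in>I. f i e) = (\<Sum>i\<in>I. sign_mean n (f i))"
  by (simp add: sign_mean_def sum.swap[of _ "sign_vectors n"] sum_divide_distrib)

lemma sign_mean_mono:
  "(\<And>e. e \<in> sign_vectors n \<Longrightarrow> f e \<le> g e) \<Longrightarrow> sign_mean n f \<le> sign_mean n g"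
  by (simp add: sign_mean_def sum_mono divide_right_mono)

lemma sign_mean_cong:
  "(\<And>e. e \<in> sign_vectors n \<Longrightarrow> f e = g e) \<Longrightarrow> sign_mean n f = sign_mean n g"
  by (simp add: sign_mean_def)

lemma sign_mean_abs: "\<bar>sign_mean n f\<bar> \<le> sign_mean n (\<lambda>e. \<bar>f e\<bar>)"
  by (simp add: sign_mean_def divide_right_mono)

abbreviation (input) rad_sum :: "nat \<Rightarrow> (nat \<Rightarrow> real) \<Rightarrow> (nat \<Rightarrow> real) \<Rightarrow> real" where
  "rad_sum n w e \<equiv> (\<Sum>j<n. e j * w j)"

lemma sign_mean_rad_sum_Suc:
  "sign_mean (Suc n) (\<lambda>e. F (rad_sum (Suc n) w e)) =
   sign_mean n (\<lambda>e. (F (rad_sum n w e + w n) + F (rad_sum n w e - w n)) / 2)"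
  by (simp add: sign_mean_Suc)

lemma sign_mean_rad_sum_square: "sign_mean n (\<lambda>e. (rad_sum n w e)\<^sup>2) = (\<Sum>j<n. (w j)\<^sup>2)"
proof (induction n)
  case 0
  show ?case by (simp add: sign_mean_0)
next
  case (Suc n)
  have eq: "((x + a)\<^sup>2 + (x - a)\<^sup>2) / 2 = x\<^sup>2 + a\<^sup>2" for x a :: real
    by algebra
  show ?case
    unfolding sign_mean_rad_sum_Suc[where F = "\<lambda>x. x\<^sup>2"] eq by (simp add: sign_mean_add Suc.IH)
qed

text \<open>Khintchine's inequality for the fourth moment, with the Gaussian constant 3. Averaging
  over the last sign removes the odd powers of its weight.\<close>

lemma sign_mean_rad_sum_fourth:
  "sign_mean n (\<lambda>e. (rad_sum n w e) ^ 4) \<le> 3 * (\<Sum>j<n. (w j)\<^sup>2)\<^sup>2"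
proof (induction n)
  case 0
  show ?case by (simp add: sign_mean_0)
next
  case (Suc n)
  have eq: "((x + a) ^ 4 + (x - a) ^ 4) / 2 = x ^ 4 + (6 * a\<^sup>2 * x\<^sup>2 + a ^ 4)" for x a :: real
    by algebra
  have "sign_mean (Suc n) (\<lambda>e. (rad_sum (Suc n) w e) ^ 4)
      = sign_mean n (\<lambda>e. (rad_sum n w e) ^ 4) + (6 * (w n)\<^sup>2 * (\<Sum>j<n. (w j)\<^sup>2) + (w n) ^ 4)"
    unfolding sign_mean_rad_sum_Suc[where F = "\<lambda>x. x ^ 4"] eq
    by (simp add: sign_mean_add sign_mean_cmult sign_mean_rad_sum_square)
  \<comment> \<open>Enlarging the last fourth power by the factor 3 completes the square.\<close>
  also have "\<dots> \<le> 3 * (\<Sum>j<n. (w j)\<^sup>2)\<^sup>2 + (6 * (w n)\<^sup>2 * (\<Sum>j<n. (w j)\<^sup>2) + 3 * (w n) ^ 4)"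
    using Suc.IH by (intro add_mono) auto
  also have "\<dots> = 3 * (\<Sum>j<Suc n. (w j)\<^sup>2)\<^sup>2"
    by simp algebra
  finally show ?case .
qed

section \<open>Orthogonality of the Walsh-Hadamard matrix\<close>

lemma hadamard_square: "hadamard m i j * hadamard m i j = 1"
  by (induction m i j rule: hadamard.induct) auto

lemma sum_lessThan_add: "(\<Sum>k<n + n. f k) = (\<Sum>k<n. f k) + (\<Sum>k<n. f (n + k) :: real)" for n :: nat
proof -
  have "(\<Sum>k<n + n. f k) = (\<Sum>k<n. f k) + (\<Sum>k=n..<n + n. f k)"
    by (metis (no_types) atLeast0LessThan le_add1 sum.atLeastLessThan_concat zero_le)
  also have "(\<Sum>k=n..<n + n. f k) = (\<Sum>k<n. f (n + k))"
    using sum.shift_bounds_nat_ivl[of f 0 n n] by (simp add: atLeast0LessThan add.commute)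
  finally show ?thesis .
qed

text \<open>Below the middle row, a column repeats its upper half, with a sign that depends only on
  the block of the column. For two columns of the same block the two half sums therefore agree; for
  columns of different blocks they cancel.\<close>

lemma hadamard_orthogonal:
  "i < 2 ^ m \<Longrightarrow> j < 2 ^ m \<Longrightarrow>
     (\<Sum>k<2 ^ m. hadamard m k i * hadamard m k j) = (if i = j then 2 ^ m else 0)"
proof (induction m arbitrary: i j)
  case 0
  then show ?case by simp
next
  case (Suc m)
  define N :: nat where "N = 2 ^ m"
  define i' where "i' = (if i < N then i else i - N)"
  define j' where "j' = (if j < N then j else j - N)"
  have ij: "i' < N" "j' < N" using Suc.prems by (auto simp: i'_def j'_def N_def)
  have lo: "hadamard (Suc m) k i = hadamard m k i'" "hadamard (Suc m) k j = hadamard m k j'" if "k < N" for k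
    using that by (auto simp: N_def i'_def j'_def)
  have hi: "hadamard (Suc m) (N + k) i = (if i < N then 1 else -1) * hadamard m k i'"
           "hadamard (Suc m) (N + k) j = (if j < N then 1 else -1) * hadamard m k j'" for k
    by (auto simp: N_def i'_def j'_def)
  have "(\<Sum>k<2 ^ Suc m. hadamard (Suc m) k i * hadamard (Suc m) k j)
     = (\<Sum>k<N + N. hadamard (Suc m) k i * hadamard (Suc m) k j)"
    by (simp add: N_def mult_2 del: hadamard.simps)
  also have "\<dots> = (\<Sum>k<N. hadamard m k i' * hadamard m k j') +
      (if (i < N) = (j < N) then 1 else -1) * (\<Sum>k<N. hadamard m k i' * hadamard m k j')"
    unfolding sum_lessThan_add hi sum_distrib_left
    by (intro arg_cong2[where f = "(+)"] sum.cong) (auto simp: lo simp del: hadamard.simps)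
  also have "(\<Sum>k<N. hadamard m k i' * hadamard m k j') = (if i' = j' then 2 ^ m else 0)"
    using Suc.IH[of i' j'] ij by (simp add: N_def)
  finally show ?case
    using Suc.prems by (auto simp: i'_def j'_def N_def split: if_splits)
qed

subsection \<open>Lindeberg replacement\<close>

abbreviation std_gauss :: "real measure" where
  "std_gauss \<equiv> density lborel std_normal_density"

text \<open>The parameter \<open>s\<close> is the variance. Scaling a standard Gaussian, instead of
  using a density of variance \<open>s\<close>, makes \<open>s = 0\<close> the point mass at 0,
  which is needed for vanishing weights and for the empty sum.\<close>

definition gauss_mean :: "real \<Rightarrow> (real \<Rightarrow> real) \<Rightarrow> real" where
  "gauss_mean s g = (\<integral>z. g (sqrt s * z) \<partial>std_gauss)"

lemma prob_space_std_gauss: "prob_space std_gauss"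
  using prob_space_normal_density[of 1 0] by simp

lemma std_gauss_moment: "has_bochner_integral std_gauss (\<lambda>z. z ^ (2 * k)) (fact (2 * k) / (2 ^ k * fact k))"
  "has_bochner_integral std_gauss (\<lambda>z. z ^ (2 * k + 1)) 0"
  by (intro has_bochner_integral_density; (use std_normal_moment_even[of k] std_normal_moment_odd[of k] in simp))+

lemma std_gauss_moments:
  "has_bochner_integral std_gauss (\<lambda>z. z) 0"
  "has_bochner_integral std_gauss (\<lambda>z. z\<^sup>2) 1"
  "has_bochner_integral std_gauss (\<lambda>z. z ^ 3) 0"
  "has_bochner_integral std_gauss (\<lambda>z. z ^ 4) 3"
  using std_gauss_moment(2)[of 0] std_gauss_moment(1)[of 1] std_gauss_moment(2)[of 1] std_gauss_moment(1)[of 2]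
  by (simp_all add: fact_numeral numeral_3_eq_3)

lemma integrable_std_gauss_bounded:
  fixes g :: "real \<Rightarrow> real"
  assumes [measurable]: "g \<in> borel_measurable borel" and "\<And>x. \<bar>g x\<bar> \<le> B"
  shows "integrable std_gauss (\<lambda>z. g (s * z))"
proof -
  interpret prob_space std_gauss by (rule prob_space_std_gauss)
  show ?thesis
    by (rule integrable_const_bound[where B = B]) (use assms(2) in auto)
qed

lemma distr_std_gauss:
  assumes "0 < a"
  shows "distr std_gauss borel (\<lambda>z. a * z) = density lborel (normal_density 0 a)"
proof -
  interpret prob_space std_gauss by (rule prob_space_std_gauss)
  have "distributed std_gauss lborel (\<lambda>x. x) std_normal_density"
    unfolding distributed_def by (simp add: distr_id2 cong: distr_cong)
  from normal_density_affine[OF this, of a 0] assms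
  have "distributed std_gauss lborel (\<lambda>x. a * x) (normal_density 0 a)"
    by simp
  then show ?thesis
    by (simp add: distributed_def cong: distr_cong)
qed

lemma gauss_mean_density:
  fixes g :: "real \<Rightarrow> real"
  assumes "0 < s" and [measurable]: "g \<in> borel_measurable borel"
  shows "gauss_mean s g = (\<integral>y. g y \<partial>density lborel (normal_density 0 (sqrt s)))"
proof -
  have "gauss_mean s g = (\<integral>y. g y \<partial>distr std_gauss borel (\<lambda>z. sqrt s * z))"
    unfolding gauss_mean_def by (subst integral_distr) auto
  then show ?thesis
    using assms by (simp add: distr_std_gauss)
qed

text \<open>Independent centred Gaussians add their variances. A zero variance is treated apart
  because the point mass has no density; otherwise Fubini, justified by boundedness, reduces the
  claim to the convolution of two densities.\<close>

lemma gauss_mean_convolution: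
  fixes g :: "real \<Rightarrow> real"
  assumes [measurable]: "g \<in> borel_measurable borel" and B: "\<And>x. \<bar>g x\<bar> \<le> B"
    and "0 \<le> a" "0 \<le> b"
  shows "gauss_mean a (\<lambda>x. gauss_mean b (\<lambda>y. g (x + y))) = gauss_mean (a + b) g"
proof -
  interpret G: prob_space std_gauss by (rule prob_space_std_gauss)
  have triv: "gauss_mean 0 h = h 0" for h
    unfolding gauss_mean_def using G.prob_space by simp
  show ?thesis
  proof (cases "a = 0 \<or> b = 0")
    case True
    then show ?thesis using triv by auto
  next
    case False
    then have ab: "0 < a" "0 < b" using assms by auto
    define A where "A = density lborel (normal_density 0 (sqrt a))"
    define C where "C = density lborel (normal_density 0 (sqrt b))"
    have [measurable_cong]: "sets A = sets borel" "sets C = sets borel"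
      by (simp_all add: A_def C_def)
    interpret A: prob_space A unfolding A_def by (rule prob_space_normal_density) (use ab in simp)
    interpret C: prob_space C unfolding C_def by (rule prob_space_normal_density) (use ab in simp)
    interpret P: pair_prob_space A C ..
    have "gauss_mean a (\<lambda>x. gauss_mean b (\<lambda>y. g (x + y))) = gauss_mean a (\<lambda>x. \<integral>y. g (x + y) \<partial>C)"
      using ab by (simp add: gauss_mean_density C_def)
    also have "\<dots> = (\<integral>x. \<integral>y. g (x + y) \<partial>C \<partial>A)"
      using ab by (subst gauss_mean_density) (auto simp: A_def)
    also have "\<dots> = (\<integral>p. g (fst p + snd p) \<partial>(A \<Otimes>\<^sub>M C))"
    proof -
      have "integrable (A \<Otimes>\<^sub>M C) (\<lambda>p. g (fst p + snd p))"
        by (rule P.integrable_const_bound[where B = B]) (use B in auto)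
      from P.integral_fst'[OF this] show ?thesis by simp
    qed
    also have "\<dots> = (\<integral>x. g x \<partial>(A \<star> C))"
      unfolding convolution_def by (subst integral_distr) (auto simp: case_prod_beta)
    also have "A \<star> C = density lborel (normal_density 0 (sqrt (a + b)))"
      unfolding A_def C_def
    proof (subst convolution_density)
      show "density lborel (\<lambda>x. \<integral>\<^sup>+y. ennreal (normal_density 0 (sqrt a) (x - y)) *
              ennreal (normal_density 0 (sqrt b) y) \<partial>lborel)
          = density lborel (\<lambda>x. ennreal (normal_density 0 (sqrt (a + b)) x))"
        using conv_normal_density_zero_mean[of "sqrt a" "sqrt b"] ab
        by (simp add: ennreal_mult'[symmetric])
    qed (use A.finite_measure_axioms C.finite_measure_axioms in \<open>auto simp: A_def C_def\<close>)
    finally show ?thesis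
      using ab by (simp add: gauss_mean_density)
  qed
qed

text \<open>A cubic Taylor expansion at every point with a remainder constant uniform in
  \<open>x\<close>. The coefficients stay anonymous: moment matching cancels them whatever they
  are.\<close>

definition fourth_order :: "real \<Rightarrow> (real \<Rightarrow> real) \<Rightarrow> bool" where
  "fourth_order K f \<longleftrightarrow>
     (\<forall>x. \<exists>a b c. \<forall>y. \<bar>f (x + y) - f x - a * y - b * y\<^sup>2 - c * y ^ 3\<bar> \<le> K * y ^ 4)"

text \<open>The two-point law on w, -w and the Gaussian of variance w^2 give the cubic Taylor
  polynomial the same mean. Only the remainders survive: at most K w^4 from the two points, and 3 K
  w^4 from the Gaussian, whose fourth moment is 3 w^4.\<close>

lemma two_point_vs_gauss:
  assumes f: "fourth_order K f" and [measurable]: "f \<in> borel_measurable borel"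
    and B: "\<And>x. \<bar>f x\<bar> \<le> B"
  shows "\<bar>(f (x + w) + f (x - w)) / 2 - gauss_mean (w\<^sup>2) (\<lambda>y. f (x + y))\<bar> \<le> 4 * K * w ^ 4"
proof -
  interpret G: prob_space std_gauss by (rule prob_space_std_gauss)
  obtain a b c where T: "\<And>y. \<bar>f (x + y) - f x - a * y - b * y\<^sup>2 - c * y ^ 3\<bar> \<le> K * y ^ 4"
    using f unfolding fourth_order_def by meson
  define r where "r y = f (x + y) - f x - a * y - b * y\<^sup>2 - c * y ^ 3" for y
  have r: "\<bar>r y\<bar> \<le> K * y ^ 4" for y using T[of y] by (simp add: r_def)
  have 1: "\<bar>(f (x + w) + f (x - w)) / 2 - (f x + b * w\<^sup>2)\<bar> \<le> K * w ^ 4"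
  proof -
    have eq: "(f (x + w) + f (x - w)) / 2 - (f x + b * w\<^sup>2) = (r w + r (-w)) / 2"
      by (simp add: r_def field_simps)
    have avg: "\<bar>(p + q) / 2\<bar> \<le> c" if "\<bar>p\<bar> \<le> c" "\<bar>q\<bar> \<le> c" for p q c :: real
    proof -
      have "\<bar>p + q\<bar> \<le> 2 * c" using that by linarith
      then show ?thesis by simp
    qed
    have "\<bar>r (- w)\<bar> \<le> K * w ^ 4" using r[of "- w"] by simp
    with r[of w] show ?thesis unfolding eq by (rule avg)
  qed
  \<comment> \<open>\<open>gauss_mean (w\<^sup>2)\<close> scales by the square root of w^2, which is
    the absolute value of \<open>w\<close>.\<close>
  define v where "v = \<bar>w\<bar>"
  have "has_bochner_integral std_gauss (\<lambda>z. f (x + v * z)) (gauss_mean (w\<^sup>2) (\<lambda>y. f (x + y)))"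
    using integrable_std_gauss_bounded[of "\<lambda>y. f (x + y)" B v] B
    by (simp add: has_bochner_integral_iff gauss_mean_def v_def)
  moreover have "has_bochner_integral std_gauss (\<lambda>z. f x) (f x)"
    using G.prob_space by (simp add: has_bochner_integral_iff)
  ultimately have "has_bochner_integral std_gauss
      (\<lambda>z. f (x + v * z) - f x - a * v * z - b * v\<^sup>2 * z\<^sup>2 - c * v ^ 3 * z ^ 3)
      (gauss_mean (w\<^sup>2) (\<lambda>y. f (x + y)) - f x - a * v * 0 - b * v\<^sup>2 * 1 - c * v ^ 3 * 0)"
    by (intro has_bochner_integral_diff has_bochner_integral_mult_right std_gauss_moments)
  then have h: "has_bochner_integral std_gauss (\<lambda>z. r (v * z))
      (gauss_mean (w\<^sup>2) (\<lambda>y. f (x + y)) - (f x + b * w\<^sup>2))"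
    by (simp add: r_def power_mult_distrib mult.assoc v_def diff_diff_eq)
  have h4: "has_bochner_integral std_gauss (\<lambda>z. K * v ^ 4 * z ^ 4) (K * v ^ 4 * 3)"
    by (intro has_bochner_integral_mult_right std_gauss_moments)
  have "\<bar>gauss_mean (w\<^sup>2) (\<lambda>y. f (x + y)) - (f x + b * w\<^sup>2)\<bar> = \<bar>\<integral>z. r (v * z) \<partial>std_gauss\<bar>"
    using h by (simp add: has_bochner_integral_iff)
  also have "\<dots> \<le> (\<integral>z. \<bar>r (v * z)\<bar> \<partial>std_gauss)"
    by (rule integral_abs_bound)
  also have "\<dots> \<le> (\<integral>z. K * v ^ 4 * z ^ 4 \<partial>std_gauss)"
    using h h4 r by (intro integral_mono) (auto simp: has_bochner_integral_iff power_mult_distrib[symmetric] mult.assoc)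
  also have "\<dots> = 3 * K * w ^ 4"
    using h4 by (simp add: has_bochner_integral_iff v_def)
  finally show ?thesis using 1 by linarith
qed

text \<open>The base point \<open>x\<close> is generalised because fixing the last sign shifts it by
  plus or minus the last weight. The induction hypothesis replaces the other signs at both shifted
  points, \<open>two_point_vs_gauss\<close> replaces the last sign under the resulting Gaussian
  integral, and the convolution lemma merges the two Gaussians.\<close>

lemma lindeberg:
  assumes f: "fourth_order K f" and [measurable]: "f \<in> borel_measurable borel"
    and B: "\<And>x. \<bar>f x\<bar> \<le> B"
  shows "\<bar>sign_mean n (\<lambda>e. f (x + rad_sum n w e)) - gauss_mean (\<Sum>j<n. (w j)\<^sup>2) (\<lambda>y. f (x + y))\<bar>
           \<le> 4 * K * (\<Sum>j<n. w j ^ 4)"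
proof (induction n arbitrary: x)
  case 0
  interpret G: prob_space std_gauss by (rule prob_space_std_gauss)
  show ?case using G.prob_space by (simp add: sign_mean_0 gauss_mean_def)
next
  case (Suc n)
  interpret G: prob_space std_gauss by (rule prob_space_std_gauss)
  define s where "s = (\<Sum>j<n. (w j)\<^sup>2)"
  define v where "v = w n"
  define L where "L = (\<Sum>j<n. w j ^ 4)"
  define S where "S x = sign_mean n (\<lambda>e. f (x + rad_sum n w e))" for x
  \<comment> \<open>The test function after the last sign has become Gaussian, as a function of the
    sum of the others.\<close>
  define h where "h y = gauss_mean (v\<^sup>2) (\<lambda>z. f (x + y + z))" for y
  have "s \<ge> 0" by (simp add: s_def sum_nonneg)
  have IH: "\<bar>S x - gauss_mean s (\<lambda>y. f (x + y))\<bar> \<le> 4 * K * L" for x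
    using Suc.IH[of x] by (simp add: S_def s_def L_def)
  have int: "integrable std_gauss (\<lambda>z. f (x + sqrt s * z))" for x
    using integrable_std_gauss_bounded[of "\<lambda>y. f (x + y)" B "sqrt s"] B by simp
  have hm [measurable]: "h \<in> borel_measurable borel"
    unfolding h_def gauss_mean_def by measurable
  have hB: "\<bar>h y\<bar> \<le> B" for y
    unfolding h_def gauss_mean_def
    using integrable_std_gauss_bounded[of "\<lambda>z. f (x + y + z)" B "sqrt (v\<^sup>2)"] B
    by (intro order.trans[OF integral_abs_bound] G.integral_le_const) auto
  have eq: "gauss_mean s (\<lambda>y. (f (x + y + v) + f (x + y - v)) / 2)
       = (gauss_mean s (\<lambda>y. f ((x + v) + y)) + gauss_mean s (\<lambda>y. f ((x - v) + y))) / 2"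
    unfolding gauss_mean_def using int[of "x + v"] int[of "x - v"] by (simp add: algebra_simps)
  have i1: "integrable std_gauss (\<lambda>z. (f (x + sqrt s * z + v) + f (x + sqrt s * z - v)) / 2)"
    using int[of "x + v"] int[of "x - v"] by (simp add: algebra_simps)
  have i2: "integrable std_gauss (\<lambda>z. h (sqrt s * z))"
    by (rule integrable_std_gauss_bounded[OF hm hB])
  have "\<bar>gauss_mean s (\<lambda>y. (f (x + y + v) + f (x + y - v)) / 2) - gauss_mean s h\<bar>
      = \<bar>\<integral>z. (f (x + sqrt s * z + v) + f (x + sqrt s * z - v)) / 2 - h (sqrt s * z) \<partial>std_gauss\<bar>"
    unfolding gauss_mean_def using i1 i2 by simp
  also have "\<dots> \<le> (\<integral>z. \<bar>(f (x + sqrt s * z + v) + f (x + sqrt s * z - v)) / 2 - h (sqrt s * z)\<bar> \<partial>std_gauss)"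
    by (rule integral_abs_bound)
  also have "\<dots> \<le> 4 * K * v ^ 4"
    using i1 i2 two_point_vs_gauss[OF f _ B] unfolding h_def
    by (intro G.integral_le_const) auto
  finally have a: "\<bar>gauss_mean s (\<lambda>y. (f (x + y + v) + f (x + y - v)) / 2) - gauss_mean s h\<bar> \<le> 4 * K * v ^ 4" .
  have "gauss_mean s h = gauss_mean (s + v\<^sup>2) (\<lambda>y. f (x + y))"
    unfolding h_def using gauss_mean_convolution[of "\<lambda>y. f (x + y)" B s "v\<^sup>2"] B \<open>s \<ge> 0\<close>
    by (simp add: add.assoc)
  moreover have "sign_mean (Suc n) (\<lambda>e. f (x + rad_sum (Suc n) w e)) = (S (x + v) + S (x - v)) / 2"
    unfolding S_def sign_mean_rad_sum_Suc[where F = "\<lambda>y. f (x + y)"] v_def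
    by (simp add: sign_mean_def sum.distrib add_divide_distrib algebra_simps sum_divide_distrib)
  ultimately show ?case
    using a eq IH[of "x + v"] IH[of "x - v"]
    by (simp add: s_def[symmetric] v_def[symmetric] L_def[symmetric] algebra_simps abs_le_iff)
qed

subsection \<open>A smooth step\<close>

definition clamp01 :: "real \<Rightarrow> real" where
  "clamp01 x = max 0 (min 1 x)"

lemma clamp01_bounds: "0 \<le> clamp01 x" "clamp01 x \<le> 1"
  by (auto simp: clamp01_def)

text \<open>Clamping glues constants to \<open>p\<close> at 0 and 1, and the vanishing of
  \<open>p'\<close> there makes the one-sided derivatives agree. Left and right limits are treated
  separately, so that on each side the clamped function is locally either \<open>p\<close> or
  constant; hence the half-open case conditions.\<close>

lemma has_field_derivative_clamp01:
  fixes p p' :: "real \<Rightarrow> real"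
  assumes D: "\<And>x. (p has_field_derivative p' x) (at x)" and "p' 0 = 0" "p' 1 = 0"
  shows "((\<lambda>x. p (clamp01 x)) has_field_derivative p' (clamp01 x)) (at x)"
proof -
  have left: "((\<lambda>y. (p (clamp01 y) - p (clamp01 x)) / (y - x)) \<longlongrightarrow> p' (clamp01 x)) (at_left x)"
  proof (cases "0 < x \<and> x \<le> 1")
    case True
    have "((\<lambda>y. (p y - p x) / (y - x)) \<longlongrightarrow> p' x) (at_left x)"
      using has_field_derivative_at_within[OF D[of x]] by (simp add: has_field_derivative_iff)
    moreover have "eventually (\<lambda>y. (p y - p x) / (y - x) = (p (clamp01 y) - p (clamp01 x)) / (y - x)) (at_left x)"
      by (rule eventually_at_leftI[of 0]) (use True in \<open>auto simp: clamp01_def\<close>)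
    ultimately have "((\<lambda>y. (p (clamp01 y) - p (clamp01 x)) / (y - x)) \<longlongrightarrow> p' x) (at_left x)"
      by (rule Lim_transform_eventually)
    moreover have "clamp01 x = x" using True by (auto simp: clamp01_def)
    ultimately show ?thesis by simp
  next
    case False
    have "eventually (\<lambda>y. (p (clamp01 y) - p (clamp01 x)) / (y - x) = 0) (at_left x)"
    proof (cases "x \<le> 0")
      case True
      then show ?thesis by (intro eventually_at_leftI[of "x - 1"]) (auto simp: clamp01_def)
    next
      case f: False
      then show ?thesis using False by (intro eventually_at_leftI[of 1]) (auto simp: clamp01_def)
    qed
    moreover have "p' (clamp01 x) = 0" using False assms by (auto simp: clamp01_def)
    ultimately show ?thesis by (simp add: tendsto_eventually)
  qed
  have right: "((\<lambda>y. (p (clamp01 y) - p (clamp01 x)) / (y - x)) \<longlongrightarrow> p' (clamp01 x)) (at_right x)"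
  proof (cases "0 \<le> x \<and> x < 1")
    case True
    have "((\<lambda>y. (p y - p x) / (y - x)) \<longlongrightarrow> p' x) (at_right x)"
      using has_field_derivative_at_within[OF D[of x]] by (simp add: has_field_derivative_iff)
    moreover have "eventually (\<lambda>y. (p y - p x) / (y - x) = (p (clamp01 y) - p (clamp01 x)) / (y - x)) (at_right x)"
      by (rule eventually_at_rightI[of _ 1]) (use True in \<open>auto simp: clamp01_def\<close>)
    ultimately have "((\<lambda>y. (p (clamp01 y) - p (clamp01 x)) / (y - x)) \<longlongrightarrow> p' x) (at_right x)"
      by (rule Lim_transform_eventually)
    moreover have "clamp01 x = x" using True by (auto simp: clamp01_def)
    ultimately show ?thesis by simp
  next
    case False
    have "eventually (\<lambda>y. (p (clamp01 y) - p (clamp01 x)) / (y - x) = 0) (at_right x)"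
    proof (cases "1 \<le> x")
      case True
      then show ?thesis by (intro eventually_at_rightI[of _ "x + 1"]) (auto simp: clamp01_def)
    next
      case f: False
      then show ?thesis using False by (intro eventually_at_rightI[of _ 0]) (auto simp: clamp01_def)
    qed
    moreover have "p' (clamp01 x) = 0" using False assms by (auto simp: clamp01_def)
    ultimately show ?thesis by (simp add: tendsto_eventually)
  qed
  show ?thesis
    unfolding has_field_derivative_iff by (rule filterlim_split_at[OF left right])
qed

text \<open>\<open>step_poly 0\<close> is the antiderivative of 630 x^4 (1 - x)^4, which rises from 0 at 0 to 1 at 1;
  \<open>step_poly k\<close> is its k-th derivative for k at most 4 (and again the fourth one for larger k).\<close>

fun step_poly :: "nat \<Rightarrow> real \<Rightarrow> real" where
  "step_poly 0 x = 126 * x ^ 5 - 420 * x ^ 6 + 540 * x ^ 7 - 315 * x ^ 8 + 70 * x ^ 9"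
| "step_poly (Suc 0) x = 630 * x ^ 4 - 2520 * x ^ 5 + 3780 * x ^ 6 - 2520 * x ^ 7 + 630 * x ^ 8"
| "step_poly (Suc (Suc 0)) x = 2520 * x ^ 3 - 12600 * x ^ 4 + 22680 * x ^ 5 - 17640 * x ^ 6 + 5040 * x ^ 7"
| "step_poly (Suc (Suc (Suc 0))) x =
     7560 * x\<^sup>2 - 50400 * x ^ 3 + 113400 * x ^ 4 - 105840 * x ^ 5 + 35280 * x ^ 6"
| "step_poly _ x = 15120 * x - 151200 * x\<^sup>2 + 453600 * x ^ 3 - 529200 * x ^ 4 + 211680 * x ^ 5"

lemma step_poly_deriv:
  assumes "k < 4"
  shows "(step_poly k has_field_derivative step_poly (Suc k) x) (at x)"
proof -
  have "k = 0 \<or> k = Suc 0 \<or> k = Suc (Suc 0) \<or> k = Suc (Suc (Suc 0))" using assms by linarith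
  then show ?thesis
  proof (elim disjE)
    assume k: "k = 0"
    show ?thesis unfolding k step_poly.simps by (auto intro!: derivative_eq_intros)
  next
    assume k: "k = Suc 0"
    show ?thesis unfolding k step_poly.simps by (auto intro!: derivative_eq_intros)
  next
    assume k: "k = Suc (Suc 0)"
    show ?thesis unfolding k step_poly.simps by (auto intro!: derivative_eq_intros)
  next
    assume k: "k = Suc (Suc (Suc 0))"
    show ?thesis unfolding k step_poly.simps by (auto intro!: derivative_eq_intros)
  qed
qed

lemma step_poly_endpoints: "k < 4 \<Longrightarrow> step_poly (Suc k) 0 = 0" "k < 4 \<Longrightarrow> step_poly (Suc k) 1 = 0"
proof -
  assume "k < 4"
  then have "k = 0 \<or> k = Suc 0 \<or> k = Suc (Suc 0) \<or> k = Suc (Suc (Suc 0))" by linarith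
  then show "step_poly (Suc k) 0 = 0" "step_poly (Suc k) 1 = 0" by auto
qed

text \<open>Up to the factor 630 this is the fourth derivative of the step, centred at 1/2. It is
  odd there, so nonnegative \<open>y\<close> suffice. The sign of the last factor decides the
  case.\<close>

lemma quintic_bound:
  fixes y :: real
  assumes "0 \<le> y" "y \<le> 1 / 2"
  shows "\<bar>3 * y * (4 * y\<^sup>2 - 1) * (28 * y\<^sup>2 - 3)\<bar> \<le> 4 / 3"
proof -
  define z where "z = y\<^sup>2"
  have z: "0 \<le> z" "z \<le> 1 / 4"
    using assms power_mono[of y "1/2" 2] by (auto simp: z_def power2_eq_square)
  show ?thesis
  proof (cases "28 * z \<le> 3")
    case True
    have "84 * y ^ 3 - 9 * y + 4 / 3 \<ge> 0"
    proof -
      \<comment> \<open>A rational stand-in for 1 / sqrt 28, the positive minimiser of 84 y^3 - 9 y;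
        the cubic with a double root at \<open>a\<close> then bounds y^3 from below by a linear
        function.\<close>
      define a :: real where "a = 19 / 100"
      have "(y - a)\<^sup>2 * (y + 2 * a) = y ^ 3 - 3 * a\<^sup>2 * y + 2 * a ^ 3" by algebra
      moreover have "(y - a)\<^sup>2 * (y + 2 * a) \<ge> 0" using assms by (simp add: a_def)
      ultimately have "y ^ 3 - 3 * (19 / 100)\<^sup>2 * y + 2 * (19 / 100) ^ 3 \<ge> 0"
        by (simp add: a_def)
      then show ?thesis using assms by (simp add: power2_eq_square power3_eq_cube)
    qed
    then have "3 * y * (3 - 28 * z) \<le> 4 / 3"
      by (simp add: z_def power2_eq_square power3_eq_cube algebra_simps)
    moreover have "3 * y * (3 - 28 * z) * (1 - 4 * z) \<le> 3 * y * (3 - 28 * z) * 1"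
      using True z assms by (intro mult_left_mono) auto
    moreover have "0 \<le> 3 * y * (3 - 28 * z) * (1 - 4 * z)"
      using True z assms by (intro mult_nonneg_nonneg) auto
    moreover have "3 * y * (4 * y\<^sup>2 - 1) * (28 * y\<^sup>2 - 3) = 3 * y * (3 - 28 * z) * (1 - 4 * z)"
      by (simp add: z_def algebra_simps)
    ultimately show ?thesis by linarith
  next
    case False
    \<comment> \<open>This quadratic in \<open>z\<close> peaks at z = 5/28 with value 4/7.\<close>
    have "(1 - 4 * z) * (28 * z - 3) \<le> 4 / 7"
    proof -
      have "0 \<le> (28 * z - 5)\<^sup>2" by simp
      then show ?thesis by (simp add: power2_eq_square algebra_simps)
    qed
    then have "y * ((1 - 4 * z) * (28 * z - 3)) \<le> 1 / 2 * (4 / 7)"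
      using assms False z by (intro mult_mono) auto
    moreover have "0 \<le> y * ((1 - 4 * z) * (28 * z - 3))"
      using False z assms by (intro mult_nonneg_nonneg) auto
    moreover have "3 * y * (4 * y\<^sup>2 - 1) * (28 * y\<^sup>2 - 3) = - 3 * (y * ((1 - 4 * z) * (28 * z - 3)))"
      by (simp add: z_def algebra_simps)
    ultimately show ?thesis by linarith
  qed
qed

text \<open>Exposes the constructors on which the equations of \<open>step_poly\<close>
  match.\<close>

lemma four_Suc: "4 = Suc (Suc (Suc (Suc 0)))"
  by simp

lemma step_poly_4_bound:
  assumes "0 \<le> x" "x \<le> 1"
  shows "\<bar>step_poly 4 x\<bar> \<le> 840"
proof -
  define y where "y = x - 1 / 2"
  have "\<bar>y\<bar> \<le> 1 / 2" using assms unfolding y_def by linarith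
  then have b: "\<bar>3 * \<bar>y\<bar> * (4 * \<bar>y\<bar>\<^sup>2 - 1) * (28 * \<bar>y\<bar>\<^sup>2 - 3)\<bar> \<le> 4 / 3"
    by (intro quintic_bound) auto
  have "step_poly 4 x = 630 * (3 * y * (4 * y\<^sup>2 - 1) * (28 * y\<^sup>2 - 3))"
  proof -
    have "4 * y\<^sup>2 - 1 = 4 * x * (x - 1)" "28 * y\<^sup>2 - 3 = 4 * (7 * x\<^sup>2 - 7 * x + 1)"
      by (simp_all add: y_def power2_eq_square field_simps)
    then have "630 * (3 * y * (4 * y\<^sup>2 - 1) * (28 * y\<^sup>2 - 3))
        = 630 * (3 * y * (4 * x * (x - 1)) * (4 * (7 * x\<^sup>2 - 7 * x + 1)))"
      by (simp only:)
    also have "\<dots> = 15120 * (2 * x - 1) * x * (x - 1) * (7 * x\<^sup>2 - 7 * x + 1)"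
      by (simp add: y_def algebra_simps)
    also have "\<dots> = step_poly 4 x"
      unfolding four_Suc step_poly.simps by (simp add: algebra_simps eval_nat_numeral)
    finally show ?thesis by simp
  qed
  then show ?thesis using b by (simp add: abs_mult)
qed

definition smooth_step :: "real \<Rightarrow> real" where
  "smooth_step x = step_poly 0 (clamp01 x)"

text \<open>Lagrange remainder of order four, with 840 / 4! = 35. Four differentiations across the
  joints are possible because the first four derivatives of the polynomial vanish at 0 and 1, which
  is why its derivative carries fourth powers of x and 1 - x.\<close>

lemma smooth_step_taylor:
  "\<exists>a b c. \<forall>y. \<bar>smooth_step (x + y) - smooth_step x - a * y - b * y\<^sup>2 - c * y ^ 3\<bar> \<le> 35 * y ^ 4"
proof (intro exI allI)
  fix y :: real
  define df where "df k t = step_poly k (clamp01 (x + t))" for k t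
  have "\<exists>t. \<bar>t\<bar> \<le> \<bar>y\<bar> \<and> df 0 y = (\<Sum>m<4. df m 0 / fact m * y ^ m) + df 4 t / fact 4 * y ^ 4"
  proof (rule Maclaurin_bi_le, simp, intro allI impI)
    fix m :: nat and t :: real
    assume "m < 4 \<and> \<bar>t\<bar> \<le> \<bar>y\<bar>"
    then have "((\<lambda>t. step_poly m (clamp01 t)) has_field_derivative step_poly (Suc m) (clamp01 (x + t))) (at (t + x))"
      unfolding add.commute[of t x] by (intro has_field_derivative_clamp01 step_poly_deriv step_poly_endpoints) auto
    then show "(df m has_field_derivative df (Suc m) t) (at t)"
      unfolding df_def DERIV_shift by (simp add: add.commute)
  qed
  then obtain t where t: "df 0 y = (\<Sum>m<4. df m 0 / fact m * y ^ m) + df 4 t / fact 4 * y ^ 4" by blast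
  have "\<bar>df 4 t\<bar> \<le> 840"
    unfolding df_def by (intro step_poly_4_bound clamp01_bounds)
  then have "\<bar>df 4 t / 24 * y ^ 4\<bar> \<le> 35 * y ^ 4"
    unfolding abs_mult by (intro mult_mono) auto
  moreover have "df 0 y - df 0 0 - df 1 0 * y - df 2 0 / 2 * y\<^sup>2 - df 3 0 / 6 * y ^ 3 = df 4 t / 24 * y ^ 4"
    using t by (simp add: lessThan_Suc fact_numeral numeral_2_eq_2 numeral_3_eq_3 four_Suc del: step_poly.simps)
  ultimately have "\<bar>df 0 y - df 0 0 - df 1 0 * y - df 2 0 / 2 * y\<^sup>2 - df 3 0 / 6 * y ^ 3\<bar> \<le> 35 * y ^ 4"
    by (simp only:)
  then show "\<bar>smooth_step (x + y) - smooth_step x - step_poly 1 (clamp01 x) * y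
       - step_poly 2 (clamp01 x) / 2 * y\<^sup>2 - step_poly 3 (clamp01 x) / 6 * y ^ 3\<bar> \<le> 35 * y ^ 4"
    by (simp only: smooth_step_def df_def add_0_right)
qed

lemma step_poly_0_mono:
  assumes "0 \<le> x" "x \<le> y" "y \<le> 1"
  shows "step_poly 0 x \<le> step_poly 0 y"
proof (rule DERIV_nonneg_imp_nondecreasing[OF assms(2)])
  fix z assume z: "x \<le> z" "z \<le> y"
  have "step_poly (Suc 0) z = 630 * (z ^ 4 * (1 - z) ^ 4)"
    unfolding step_poly.simps by algebra
  then have "step_poly (Suc 0) z \<ge> 0"
    using z assms by simp
  then show "\<exists>D. (step_poly 0 has_field_derivative D) (at z) \<and> D \<ge> 0"
    using step_poly_deriv[of 0 z] by auto
qed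

lemma smooth_step_bounds: "0 \<le> smooth_step x" "smooth_step x \<le> 1"
  using step_poly_0_mono[of 0 "clamp01 x"] step_poly_0_mono[of "clamp01 x" 1]
  by (simp_all add: smooth_step_def clamp01_bounds)

lemma smooth_step_eq_0: "x \<le> 0 \<Longrightarrow> smooth_step x = 0"
  by (simp add: smooth_step_def clamp01_def)

lemma smooth_step_eq_1: "1 \<le> x \<Longrightarrow> smooth_step x = 1"
  by (simp add: smooth_step_def clamp01_def)

lemma smooth_step_measurable [measurable]: "smooth_step \<in> borel_measurable borel"
  unfolding smooth_step_def clamp01_def step_poly.simps by measurable

section \<open>Smoothed indicators of half lines\<close>

definition fall :: "real \<Rightarrow> real \<Rightarrow> real \<Rightarrow> real" where
  "fall r \<epsilon> x = 1 - smooth_step ((x - r) / \<epsilon>)"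

lemma fall_measurable [measurable]: "fall r \<epsilon> \<in> borel_measurable borel"
  unfolding fall_def by measurable

lemma fall_bounds: "0 \<le> fall r \<epsilon> x" "fall r \<epsilon> x \<le> 1"
  using smooth_step_bounds by (auto simp: fall_def)

lemma fall_abs: "\<bar>fall r \<epsilon> x\<bar> \<le> 1"
  using fall_bounds[of r \<epsilon> x] by simp

lemma fall_ge_indicator: "0 < \<epsilon> \<Longrightarrow> indicator {..r} x \<le> fall r \<epsilon> x"
  using fall_bounds(1)[of r \<epsilon> x]
  by (auto simp: fall_def smooth_step_eq_0 divide_nonpos_pos split: split_indicator)

text \<open>Starting the descent at r - \<epsilon> instead of r turns the majorant of the indicator
  into a minorant.\<close>

lemma fall_le_indicator: "0 < \<epsilon> \<Longrightarrow> fall (r - \<epsilon>) \<epsilon> x \<le> indicator {..r} x"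
  using fall_bounds(2)[of "r - \<epsilon>" \<epsilon> x]
  by (auto simp: fall_def smooth_step_eq_1 pos_le_divide_eq split: split_indicator)

text \<open>Rescaling the argument by 1/\<epsilon> multiplies the quartic remainder by
  \<epsilon>^(-4).\<close>

lemma fourth_order_fall:
  assumes "0 < \<epsilon>"
  shows "fourth_order (35 / \<epsilon> ^ 4) (fall r \<epsilon>)"
  unfolding fourth_order_def
proof
  fix x
  define z where "z = (x - r) / \<epsilon>"
  obtain a b c where T:
    "\<And>y. \<bar>smooth_step (z + y) - smooth_step z - a * y - b * y\<^sup>2 - c * y ^ 3\<bar> \<le> 35 * y ^ 4"
    using smooth_step_taylor[of z] by blast
  show "\<exists>a b c. \<forall>y. \<bar>fall r \<epsilon> (x + y) - fall r \<epsilon> x - a * y - b * y\<^sup>2 - c * y ^ 3\<bar> \<le> 35 / \<epsilon> ^ 4 * y ^ 4"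
  proof (intro exI allI)
    fix y
    have "(x + y - r) / \<epsilon> = z + y / \<epsilon>"
      by (simp add: z_def add_divide_distrib diff_divide_distrib)
    then have "fall r \<epsilon> (x + y) - fall r \<epsilon> x - (- a / \<epsilon>) * y - (- b / \<epsilon>\<^sup>2) * y\<^sup>2 - (- c / \<epsilon> ^ 3) * y ^ 3
      = - (smooth_step (z + y / \<epsilon>) - smooth_step z - a * (y / \<epsilon>) - b * (y / \<epsilon>)\<^sup>2 - c * (y / \<epsilon>) ^ 3)"
      by (simp add: fall_def z_def power_divide)
    then show "\<bar>fall r \<epsilon> (x + y) - fall r \<epsilon> x - (- a / \<epsilon>) * y - (- b / \<epsilon>\<^sup>2) * y\<^sup>2 - (- c / \<epsilon> ^ 3) * y ^ 3\<bar>
        \<le> 35 / \<epsilon> ^ 4 * y ^ 4"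
      using T[of "y / \<epsilon>"] by (simp only: abs_minus_cancel) (simp add: power_divide)
  qed
qed

lemma has_integral_smooth_step:
  assumes "0 < \<epsilon>"
  shows "has_bochner_integral lborel (\<lambda>x. smooth_step ((x - r) / \<epsilon>) * indicator {r..r + \<epsilon>} x) (\<epsilon> / 2)"
proof -
  \<comment> \<open>The antiderivative of \<open>step_poly 0\<close> with P 0 = 0; P 1 = 1/2
    reflects the symmetry of the step about its midpoint.\<close>
  define P :: "real \<Rightarrow> real" where
    "P z = 21 * z ^ 6 - 60 * z ^ 7 + 135 / 2 * z ^ 8 - 35 * z ^ 9 + 7 * z ^ 10" for z
  have P: "(P has_field_derivative step_poly 0 z) (at z)" for z
    unfolding P_def step_poly.simps by (auto intro!: derivative_eq_intros)
  have F: "((\<lambda>x. \<epsilon> * P ((x - r) / \<epsilon>)) has_field_derivative step_poly 0 ((x - r) / \<epsilon>)) (at x)" for x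
    by (rule derivative_eq_intros DERIV_chain2[OF P] refl | use assms in simp)+
  have c: "isCont (\<lambda>x. step_poly 0 ((x - r) / \<epsilon>)) x" for x
    unfolding step_poly.simps using assms by (intro continuous_intros) auto
  have "has_bochner_integral lborel (\<lambda>x. step_poly 0 ((x - r) / \<epsilon>) * indicator {r..r + \<epsilon>} x)
      (\<epsilon> * P ((r + \<epsilon> - r) / \<epsilon>) - \<epsilon> * P ((r - r) / \<epsilon>))"
    using assms by (intro has_bochner_integral_FTC_Icc_real F c) auto
  also have "\<epsilon> * P ((r + \<epsilon> - r) / \<epsilon>) - \<epsilon> * P ((r - r) / \<epsilon>) = \<epsilon> / 2"
    using assms by (simp add: P_def)
  also have "(\<lambda>x. step_poly 0 ((x - r) / \<epsilon>) * indicator {r..r + \<epsilon>} x)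
      = (\<lambda>x. smooth_step ((x - r) / \<epsilon>) * indicator {r..r + \<epsilon>} x)"
  proof
    fix x
    have "clamp01 ((x - r) / \<epsilon>) = (x - r) / \<epsilon>" if "r \<le> x" "x \<le> r + \<epsilon>"
    proof -
      have "0 \<le> (x - r) / \<epsilon>" "(x - r) / \<epsilon> \<le> 1"
        using that assms by (simp_all add: divide_le_eq)
      then show ?thesis by (simp add: clamp01_def)
    qed
    then show "step_poly 0 ((x - r) / \<epsilon>) * indicator {r..r + \<epsilon>} x
        = smooth_step ((x - r) / \<epsilon>) * indicator {r..r + \<epsilon>} x"
      by (auto simp: smooth_step_def simp del: step_poly.simps split: split_indicator)
  qed
  finally show ?thesis .
qed

lemma has_integral_fall:
  assumes "0 < \<epsilon>"
  shows "has_bochner_integral lborel (\<lambda>x. fall r \<epsilon> x * indicator {r..r + \<epsilon>} x) (\<epsilon> / 2)"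
proof -
  have "has_bochner_integral lborel (\<lambda>x. indicator {r..r + \<epsilon>} x :: real) \<epsilon>"
    using assms has_bochner_integral_real_indicator[of "{r..r + \<epsilon>}" lborel] by simp
  from has_bochner_integral_diff[OF this has_integral_smooth_step[OF assms]]
  show ?thesis by (simp add: fall_def left_diff_distrib)
qed

text \<open>The gap between majorant and minorant has total area \<epsilon>, half from the rising
  and half from the falling flank, and the Gaussian density never exceeds 1 / sqrt (2 pi).\<close>

lemma gauss_mean_fall_diff:
  assumes "0 < \<epsilon>"
  shows "gauss_mean 1 (fall s \<epsilon>) - gauss_mean 1 (fall (s - \<epsilon>) \<epsilon>) \<le> \<epsilon> / sqrt (2 * pi)"
proof -
  \<comment> \<open>The closed intervals overlap at \<open>s\<close>, where both summands equal 1.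
    There \<open>h\<close> exceeds the difference, so only an inequality holds pointwise; the
    integral is unaffected.\<close>
  define h where "h x = fall s \<epsilon> x * indicator {s..s + \<epsilon>} x
      + smooth_step ((x - (s - \<epsilon>)) / \<epsilon>) * indicator {s - \<epsilon>..s - \<epsilon> + \<epsilon>} x" for x
  have h: "has_bochner_integral lborel h \<epsilon>"
    using has_bochner_integral_add[OF has_integral_fall[OF assms, of s] has_integral_smooth_step[OF assms, of "s - \<epsilon>"]]
    by (simp add: h_def[abs_def])
  have le: "fall s \<epsilon> x - fall (s - \<epsilon>) \<epsilon> x \<le> h x" for x
  proof -
    consider "x < s - \<epsilon>" | "s - \<epsilon> \<le> x" "x < s" | "s \<le> x" "x \<le> s + \<epsilon>" | "s + \<epsilon> < x" by linarith
    then show ?thesis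
    proof cases
      case 1
      then have "(x - s) / \<epsilon> \<le> 0" "(x - (s - \<epsilon>)) / \<epsilon> \<le> 0"
        using assms by (auto intro!: divide_nonpos_pos)
      then show ?thesis using 1 assms by (simp add: h_def fall_def smooth_step_eq_0)
    next
      case 2
      then have "(x - s) / \<epsilon> \<le> 0"
        using assms by (auto intro!: divide_nonpos_pos)
      then show ?thesis using 2 assms by (simp add: h_def fall_def smooth_step_eq_0)
    next
      case 3
      then have "(x - (s - \<epsilon>)) / \<epsilon> \<ge> 1" using assms by (simp add: pos_le_divide_eq)
      then show ?thesis using 3 assms smooth_step_bounds(1)[of "(x - (s - \<epsilon>)) / \<epsilon>"]
        by (auto simp: h_def fall_def smooth_step_eq_1 split: split_indicator)
    next
      case 4
      then have "(x - (s - \<epsilon>)) / \<epsilon> \<ge> 1" "(x - s) / \<epsilon> \<ge> 1" using assms by (simp_all add: pos_le_divide_eq)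
      then show ?thesis using 4 assms by (simp add: h_def fall_def smooth_step_eq_1)
    qed
  qed
  have h0: "0 \<le> h x" for x
    using fall_bounds smooth_step_bounds by (simp add: h_def)
  have \<phi>: "std_normal_density x \<le> 1 / sqrt (2 * pi)" for x
    unfolding std_normal_density_def by (simp add: divide_right_mono)
  have gm: "gauss_mean 1 (fall r \<epsilon>) = (\<integral>x. std_normal_density x * fall r \<epsilon> x \<partial>lborel)" for r
    unfolding gauss_mean_def by (subst integral_density) auto
  have gi: "integrable lborel (\<lambda>x. std_normal_density x * fall r \<epsilon> x)" for r
  proof -
    have "integrable std_gauss (fall r \<epsilon>)"
      using integrable_std_gauss_bounded[of "fall r \<epsilon>" 1 1] fall_abs by simp
    then show ?thesis
      by (simp add: integrable_density)
  qed
  have "gauss_mean 1 (fall s \<epsilon>) - gauss_mean 1 (fall (s - \<epsilon>) \<epsilon>)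
      = (\<integral>x. std_normal_density x * fall s \<epsilon> x - std_normal_density x * fall (s - \<epsilon>) \<epsilon> x \<partial>lborel)"
    unfolding gm by (rule Bochner_Integration.integral_diff[symmetric]) (rule gi)+
  also have "\<dots> \<le> (\<integral>x. 1 / sqrt (2 * pi) * h x \<partial>lborel)"
  proof (rule integral_mono)
    show "std_normal_density x * fall s \<epsilon> x - std_normal_density x * fall (s - \<epsilon>) \<epsilon> x
        \<le> 1 / sqrt (2 * pi) * h x" for x
    proof -
      have "std_normal_density x * (fall s \<epsilon> x - fall (s - \<epsilon>) \<epsilon> x) \<le> std_normal_density x * h x"
        by (intro mult_left_mono le) simp
      also have "\<dots> \<le> 1 / sqrt (2 * pi) * h x"
        by (intro mult_right_mono \<phi> h0)
      finally show ?thesis by (simp add: right_diff_distrib)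
    qed
  qed (use gi h in \<open>auto simp: has_bochner_integral_iff\<close>)
  also have "\<dots> = \<epsilon> / sqrt (2 * pi)"
    using h by (simp add: has_bochner_integral_iff)
  finally show ?thesis .
qed

subsection \<open>The randomized Hadamard transform\<close>

text \<open>Serves both the Hadamard matrix, with c = 2^m, and orthogonal matrices, with c =
  1.\<close>

lemma sum_square_orthogonal:
  fixes A :: "nat \<Rightarrow> nat \<Rightarrow> real"
  assumes "\<And>i j. i < n \<Longrightarrow> j < n \<Longrightarrow> (\<Sum>k<n. A k i * A k j) = (if i = j then c else 0)"
  shows "(\<Sum>k<n. (\<Sum>l<n. A k l * x l)\<^sup>2) = c * (\<Sum>l<n. (x l)\<^sup>2)"
proof -
  have "(\<Sum>k<n. (\<Sum>l<n. A k l * x l)\<^sup>2) = (\<Sum>k<n. \<Sum>i<n. \<Sum>j<n. (x i * x j) * (A k i * A k j))"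
    by (simp add: power2_eq_square sum_product mult_ac)
  also have "\<dots> = (\<Sum>i<n. \<Sum>k<n. \<Sum>j<n. (x i * x j) * (A k i * A k j))"
    by (rule sum.swap)
  also have "\<dots> = (\<Sum>i<n. \<Sum>j<n. \<Sum>k<n. (x i * x j) * (A k i * A k j))"
    by (intro sum.cong refl sum.swap)
  also have "\<dots> = (\<Sum>i<n. \<Sum>j<n. (x i * x j) * (\<Sum>k<n. A k i * A k j))"
    by (simp only: sum_distrib_left)
  also have "\<dots> = (\<Sum>i<n. \<Sum>j<n. if i = j then c * (x i)\<^sup>2 else 0)"
    by (intro sum.cong refl) (auto simp: assms power2_eq_square)
  also have "\<dots> = c * (\<Sum>l<n. (x l)\<^sup>2)"
    by (simp add: sum.delta sum_distrib_left)
  finally show ?thesis .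
qed

lemma hadamard_power2: "(hadamard m i j)\<^sup>2 = 1"
  using hadamard_square by (simp add: power2_eq_square)

lemma hadamard_power4: "hadamard m i j ^ 4 = 1"
  using hadamard_power2[of m i j] by (metis mult_2 numeral_Bit0 power_mult power_one)

text \<open>Entries of absolute value 1 change neither the squares nor the fourth powers of the
  weights, so the bound is the same for every row \<open>k\<close>.\<close>

lemma lindeberg_hadamard:
  assumes f: "fourth_order K f" "f \<in> borel_measurable borel" "\<And>x. \<bar>f x\<bar> \<le> B"
    and x: "(\<Sum>j<n. (x j)\<^sup>2) = 1"
  shows "\<bar>sign_mean n (\<lambda>e. f (\<Sum>j<n. e j * (hadamard m k j * x j))) - gauss_mean 1 f\<bar>
           \<le> 4 * K * (\<Sum>j<n. x j ^ 4)"
  using lindeberg[OF f, of n 0 "\<lambda>j. hadamard m k j * x j"] x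
  by (simp add: power_mult_distrib hadamard_power2 hadamard_power4)

lemma fourth_moment_hadamard:
  assumes x: "(\<Sum>j<n. (x j)\<^sup>2) = 1"
  shows "sign_mean n (\<lambda>e. (\<Sum>j<n. e j * (hadamard m k j * x j)) ^ 4) \<le> 3"
  using sign_mean_rad_sum_fourth[of n "\<lambda>j. hadamard m k j * x j"] x
  by (simp add: power_mult_distrib hadamard_power2)

lemma fourth_order_nonneg: "fourth_order K f \<Longrightarrow> 0 \<le> K"
  unfolding fourth_order_def by (metis abs_ge_zero mult.right_neutral order_trans power_one)

lemma T_coord_smooth:
  fixes u :: "nat \<Rightarrow> real" and m k :: nat
  defines "d \<equiv> 2 ^ m :: nat"
  assumes f: "fourth_order K f" "f \<in> borel_measurable borel" "\<And>x. \<bar>f x\<bar> \<le> B"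
    and u: "(\<Sum>l<d. (u l)\<^sup>2) = 1"
  shows "\<bar>sign_mean d (\<lambda>e2. sign_mean d (\<lambda>e1. f (sqrt d * T_coord m u k e1 e2))) - gauss_mean 1 f\<bar>
           \<le> 12 * K / d"
proof -
  have d: "real d > 0" by (simp add: d_def)
  \<comment> \<open>Coordinate \<open>j\<close> of H D2 u / sqrt d: a unit vector of weights for
    fixed \<open>e2\<close>, and itself a Rademacher sum in \<open>e2\<close>, whence its fourth
    moment bound.\<close>
  define v where "v e2 j = (\<Sum>l<d. e2 l * (hadamard m j l * u l)) / sqrt d" for e2 :: "nat \<Rightarrow> real" and j
  have T: "sqrt d * T_coord m u k e1 e2 = (\<Sum>j<d. e1 j * (hadamard m k j * v e2 j))" for e1 e2
  proof -
    have "sqrt d * T_coord m u k e1 e2 = (sqrt d * (1 / real d)) *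
        (\<Sum>j<d. \<Sum>l<d. hadamard m k j * e1 j * hadamard m j l * e2 l * u l)"
      unfolding T_coord_def d_def[symmetric] by (rule mult.assoc[symmetric])
    also have "sqrt d * (1 / real d) = 1 / sqrt d"
      using d by (simp add: real_div_sqrt field_simps)
    also have "1 / sqrt d * (\<Sum>j<d. \<Sum>l<d. hadamard m k j * e1 j * hadamard m j l * e2 l * u l)
        = (\<Sum>j<d. e1 j * (hadamard m k j * v e2 j))"
      by (simp add: v_def sum_distrib_left sum_divide_distrib mult_ac)
    finally show ?thesis .
  qed
  have v1: "(\<Sum>j<d. (v e j)\<^sup>2) = 1" if e: "e \<in> sign_vectors d" for e
  proof -
    have "(\<Sum>j<d. (\<Sum>l<d. hadamard m j l * (e l * u l))\<^sup>2) = 2 ^ m * (\<Sum>l<d. (e l * u l)\<^sup>2)"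
      by (rule sum_square_orthogonal) (simp add: d_def hadamard_orthogonal)
    also have "(\<Sum>l<d. (e l * u l)\<^sup>2) = (\<Sum>l<d. (u l)\<^sup>2)"
      using sign_vectors_square[OF e] by (intro sum.cong) (auto simp: power_mult_distrib power2_eq_square)
    finally have "(\<Sum>j<d. (\<Sum>l<d. e l * (hadamard m j l * u l))\<^sup>2) = d"
      using u by (simp add: d_def mult_ac)
    then show ?thesis
      using d by (simp add: v_def power_divide sum_divide_distrib[symmetric])
  qed
  have v4: "sign_mean d (\<lambda>e. v e j ^ 4) \<le> 3 / d\<^sup>2" for j
  proof -
    have "sqrt d ^ 4 = d\<^sup>2"
      using d by (metis mult_2 numeral_Bit0 of_nat_0_le_iff power_mult real_sqrt_pow2 of_nat_power)
    then have "v e j ^ 4 = 1 / d\<^sup>2 * (\<Sum>l<d. e l * (hadamard m j l * u l)) ^ 4" for e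
      by (simp add: v_def power_divide)
    then have "sign_mean d (\<lambda>e. v e j ^ 4)
        = 1 / d\<^sup>2 * sign_mean d (\<lambda>e. (\<Sum>l<d. e l * (hadamard m j l * u l)) ^ 4)"
      by (simp only: sign_mean_cmult)
    then show ?thesis
      using fourth_moment_hadamard[OF u, of m j] by (simp add: divide_right_mono)
  qed
  have K: "0 \<le> K" using f by (rule_tac fourth_order_nonneg)
  have "\<bar>sign_mean d (\<lambda>e2. sign_mean d (\<lambda>e1. f (sqrt d * T_coord m u k e1 e2))) - gauss_mean 1 f\<bar>
      = \<bar>sign_mean d (\<lambda>e2. sign_mean d (\<lambda>e1. f (sqrt d * T_coord m u k e1 e2)) - gauss_mean 1 f)\<bar>"
    by (simp add: sign_mean_diff)
  also have "\<dots> \<le> sign_mean d (\<lambda>e2. \<bar>sign_mean d (\<lambda>e1. f (sqrt d * T_coord m u k e1 e2)) - gauss_mean 1 f\<bar>)"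
    by (rule sign_mean_abs)
  \<comment> \<open>Conditionally on \<open>e2\<close> the weights are fixed, and Lindeberg applies
    to the signs \<open>e1\<close> alone.\<close>
  also have "\<dots> \<le> sign_mean d (\<lambda>e2. 4 * K * (\<Sum>j<d. v e2 j ^ 4))"
    unfolding T by (intro sign_mean_mono lindeberg_hadamard[OF f] v1)
  also have "\<dots> = 4 * K * (\<Sum>j<d. sign_mean d (\<lambda>e2. v e2 j ^ 4))"
    by (simp only: sign_mean_cmult sign_mean_sum)
  also have "\<dots> \<le> 4 * K * (\<Sum>j<d. 3 / d\<^sup>2)"
    using K v4 by (intro mult_left_mono sum_mono) auto
  also have "\<dots> = 12 * K / d"
    using d by (simp add: power2_eq_square)
  finally show ?thesis .
qed

text \<open>The iterated average puts \<open>e2\<close> outside, ready for conditioning on the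
  weights.\<close>

lemma T_cdf_eq_sign_mean:
  "T_cdf m u k t = sign_mean (2 ^ m) (\<lambda>e2. sign_mean (2 ^ m) (\<lambda>e1. indicator {..t} (T_coord m u k e1 e2)))"
proof -
  define V where "V = sign_vectors (2 ^ m)"
  have V: "V \<times> V \<noteq> {}" "finite (V \<times> V)" by (auto simp: V_def)
  have "T_cdf m u k t
     = (\<integral>p. indicator {p. T_coord m u k (fst p) (snd p) \<le> t} p \<partial>measure_pmf (pmf_of_set (V \<times> V)))"
    unfolding T_cdf_def V_def by simp
  also have "\<dots> = (\<Sum>p\<in>V \<times> V. indicator {p. T_coord m u k (fst p) (snd p) \<le> t} p) / card (V \<times> V)"
    by (rule integral_pmf_of_set[OF V])
  also have "(\<Sum>p\<in>V \<times> V. indicator {p. T_coord m u k (fst p) (snd p) \<le> t} p :: real)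
     = (\<Sum>(e1, e2)\<in>V \<times> V. indicator {..t} (T_coord m u k e1 e2))"
    by (intro sum.cong) (auto split: split_indicator)
  also have "\<dots> = (\<Sum>e2\<in>V. \<Sum>e1\<in>V. indicator {..t} (T_coord m u k e1 e2))"
    by (simp only: sum.cartesian_product[symmetric]) (rule sum.swap)
  finally show ?thesis
    by (simp add: sign_mean_def V_def card_cartesian_product sum_divide_distrib)
qed

subsection \<open>The Haar rotation\<close>

definition mat_vec :: "nat \<Rightarrow> (nat \<Rightarrow> real) \<Rightarrow> ((nat \<times> nat) \<Rightarrow> real) \<Rightarrow> nat \<Rightarrow> real" where
  "mat_vec d u R k = (\<Sum>l<d. R (k, l) * u l)"

lemma mat_vec_measurable:
  assumes "k < d"
  shows "(\<lambda>R. mat_vec d u R k) \<in> borel_measurable (mat_space d)"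
  unfolding mat_vec_def mat_space_def
  using assms by (intro borel_measurable_sum borel_measurable_times measurable_component_singleton) auto

lemma mat_mult_measurable: "mat_mult d Q \<in> measurable (mat_space d) (mat_space d)"
proof -
  have "(\<lambda>R. \<Sum>k<d. Q (i, k) * R (k, j)) \<in> borel_measurable (mat_space d)" if "i < d" "j < d" for i j
    unfolding mat_space_def
    using that by (intro borel_measurable_sum borel_measurable_times measurable_component_singleton) auto
  then show ?thesis
    unfolding mat_mult_def[abs_def]
    by (subst (2) mat_space_def) (rule measurable_restrict, auto)
qed

lemma mat_vec_mat_mult:
  assumes "k < d"
  shows "mat_vec d u (mat_mult d Q R) k = (\<Sum>j<d. Q (k, j) * mat_vec d u R j)"
proof -
  have "mat_vec d u (mat_mult d Q R) k = (\<Sum>l<d. \<Sum>j<d. Q (k, j) * (R (j, l) * u l))"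
    using assms by (simp add: mat_vec_def mat_mult_def sum_distrib_right mult.assoc)
  also have "\<dots> = (\<Sum>j<d. \<Sum>l<d. Q (k, j) * (R (j, l) * u l))"
    by (rule sum.swap)
  finally show ?thesis
    by (simp add: mat_vec_def sum_distrib_left)
qed

lemma mat_vec_norm:
  assumes "orth_mat d R"
  shows "(\<Sum>k<d. (mat_vec d u R k)\<^sup>2) = (\<Sum>l<d. (u l)\<^sup>2)"
  using sum_square_orthogonal[of d "\<lambda>i j. R (i, j)" 1 u] assms
  by (simp add: orth_mat_def mat_vec_def)

text \<open>For each sign vector \<open>e\<close>, invariance under H D_e / sqrt d rewrites the left
  integral as that of a signed sum of the coordinates of R u. As the left side does not depend on
  \<open>e\<close>, averaging over all \<open>e\<close> is free.\<close>

lemma haar_sign_mean: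
  fixes m k :: nat and M :: "((nat \<times> nat) \<Rightarrow> real) measure"
  defines "d \<equiv> 2 ^ m :: nat"
  assumes M: "haar_orth d M" and k: "k < d"
    and g [measurable]: "g \<in> borel_measurable borel" and B: "\<And>x. \<bar>g x\<bar> \<le> B"
  shows "(\<integral>R. g (sqrt d * mat_vec d u R k) \<partial>M)
     = (\<integral>R. sign_mean d (\<lambda>e. g (\<Sum>j<d. e j * (hadamard m k j * mat_vec d u R j))) \<partial>M)"
proof -
  interpret prob_space M using M by (simp add: haar_orth_def)
  have [measurable_cong]: "sets M = sets (mat_space d)" using M by (simp add: haar_orth_def)
  note [measurable] = mat_vec_measurable mat_mult_measurable
  have d: "real d > 0" by (simp add: d_def)
  have inv: "(\<integral>R. g (sqrt d * mat_vec d u R k) \<partial>M)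
      = (\<integral>R. g (\<Sum>j<d. e j * (hadamard m k j * mat_vec d u R j)) \<partial>M)" if e: "e \<in> sign_vectors d" for e
  proof -
    \<comment> \<open>The matrix H D_e / sqrt d; the restriction makes it a point of the product
      space, whose elements are extensional.\<close>
    define Q where "Q = restrict (\<lambda>(i, j). hadamard m i j * e j / sqrt d) ({0..<d} \<times> {0..<d})"
    have Q: "Q \<in> space (mat_space d)"
      by (auto simp: Q_def mat_space_def space_PiM)
    have "orth_mat d Q"
      unfolding orth_mat_def
    proof (intro allI impI)
      fix i j assume ij: "i < d" "j < d"
      have "(\<Sum>k<d. Q (k, i) * Q (k, j)) = (\<Sum>k<d. e i * e j / d * (hadamard m k i * hadamard m k j))"
        using ij by (intro sum.cong) (auto simp: Q_def)
      also have "\<dots> = e i * e j / d * (\<Sum>k<d. hadamard m k i * hadamard m k j)"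
        by (simp add: sum_distrib_left)
      also have "\<dots> = (if i = j then 1 else 0)"
        using ij sign_vectors_square[OF e] d hadamard_orthogonal[of i m j] by (simp add: d_def)
      finally show "(\<Sum>k<d. Q (k, i) * Q (k, j)) = (if i = j then 1 else 0)" .
    qed
    with Q M have eq: "distr M (mat_space d) (mat_mult d Q) = M"
      by (simp add: haar_orth_def)
    have "(\<integral>R. g (sqrt d * mat_vec d u R k) \<partial>M)
        = (\<integral>R. g (sqrt d * mat_vec d u R k) \<partial>distr M (mat_space d) (mat_mult d Q))"
      by (simp only: eq)
    also have "\<dots> = (\<integral>R. g (sqrt d * mat_vec d u (mat_mult d Q R) k) \<partial>M)"
      using k by (intro integral_distr) measurable
    also have "\<dots> = (\<integral>R. g (\<Sum>j<d. e j * (hadamard m k j * mat_vec d u R j)) \<partial>M)"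
      using k d by (intro Bochner_Integration.integral_cong refl arg_cong[where f = g])
        (simp add: mat_vec_mat_mult sum_distrib_left Q_def mult_ac)
    finally show ?thesis .
  qed
  have int: "integrable M (\<lambda>R. g (\<Sum>j<d. e j * (hadamard m k j * mat_vec d u R j)))" for e
    using B by (intro integrable_const_bound[where B = B]) auto
  have "(\<integral>R. g (sqrt d * mat_vec d u R k) \<partial>M) = sign_mean d (\<lambda>e. \<integral>R. g (sqrt d * mat_vec d u R k) \<partial>M)"
    by simp
  also have "\<dots> = sign_mean d (\<lambda>e. \<integral>R. g (\<Sum>j<d. e j * (hadamard m k j * mat_vec d u R j)) \<partial>M)"
    by (rule sign_mean_cong) (rule inv)
  also have "\<dots> = (\<integral>R. sign_mean d (\<lambda>e. g (\<Sum>j<d. e j * (hadamard m k j * mat_vec d u R j))) \<partial>M)"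
    unfolding sign_mean_def using int by simp
  finally show ?thesis .
qed

lemma haar_fourth_moment:
  fixes m j :: nat and M :: "((nat \<times> nat) \<Rightarrow> real) measure"
  defines "d \<equiv> 2 ^ m :: nat"
  assumes M: "haar_orth d M" and j: "j < d" and u: "(\<Sum>l<d. (u l)\<^sup>2) = 1"
  shows "integrable M (\<lambda>R. mat_vec d u R j ^ 4)" "(\<integral>R. mat_vec d u R j ^ 4 \<partial>M) \<le> 3 / d\<^sup>2"
proof -
  interpret prob_space M using M by (simp add: haar_orth_def)
  have [measurable_cong]: "sets M = sets (mat_space d)" using M by (simp add: haar_orth_def)
  note [measurable] = mat_vec_measurable
  have d: "real d > 0" by (simp add: d_def)
  have orth: "AE R in M. orth_mat d R" using M by (simp add: haar_orth_def)
  \<comment> \<open>\<open>haar_sign_mean\<close> wants a bounded function, hence the cut at 1.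
    Coordinates of a unit vector have fourth power at most 1, so the cut is inactive almost surely;
    after the signs are inserted it can simply be dropped in an upper bound.\<close>
  define g :: "real \<Rightarrow> real" where "g y = min 1 (y ^ 4 / d\<^sup>2)" for y
  have [measurable]: "g \<in> borel_measurable borel" unfolding g_def by measurable
  have gB: "\<bar>g y\<bar> \<le> 1" for y by (auto simp: g_def)
  have d4: "sqrt d ^ 4 = d\<^sup>2"
    by (metis mult_2 numeral_Bit0 of_nat_0_le_iff power_mult real_sqrt_pow2 of_nat_power)
  have eq: "AE R in M. mat_vec d u R j ^ 4 = g (sqrt d * mat_vec d u R j)"
    using orth
  proof eventually_elim
    case (elim R)
    have "(mat_vec d u R j)\<^sup>2 \<le> (\<Sum>k<d. (mat_vec d u R k)\<^sup>2)"
      using j by (intro member_le_sum) auto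
    then have "(mat_vec d u R j)\<^sup>2 \<le> 1"
      using mat_vec_norm[OF elim, of u] u by simp
    then have "((mat_vec d u R j)\<^sup>2)\<^sup>2 \<le> 1"
      using power_le_one[of "(mat_vec d u R j)\<^sup>2" 2] by simp
    then have "mat_vec d u R j ^ 4 \<le> 1" by simp
    then show ?case
      using d by (simp add: g_def power_mult_distrib d4)
  qed
  have i: "integrable M (\<lambda>R. g (sqrt d * mat_vec d u R j))"
    using j gB by (intro integrable_const_bound[where B = 1]) auto
  show "integrable M (\<lambda>R. mat_vec d u R j ^ 4)"
    using i integrable_cong_AE[of "\<lambda>R. mat_vec d u R j ^ 4" M "\<lambda>R. g (sqrt d * mat_vec d u R j)"] j eq
    by simp
  have "(\<integral>R. mat_vec d u R j ^ 4 \<partial>M) = (\<integral>R. g (sqrt d * mat_vec d u R j) \<partial>M)"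
    by (rule integral_cong_AE) (use j eq in auto)
  also have "\<dots> = (\<integral>R. sign_mean d (\<lambda>e. g (\<Sum>l<d. e l * (hadamard m j l * mat_vec d u R l))) \<partial>M)"
    unfolding d_def by (rule haar_sign_mean) (use M j gB in \<open>auto simp: d_def\<close>)
  also have "\<dots> \<le> (\<integral>R. 3 / d\<^sup>2 \<partial>M)"
  proof (rule integral_mono_AE)
    show "integrable M (\<lambda>R. sign_mean d (\<lambda>e. g (\<Sum>l<d. e l * (hadamard m j l * mat_vec d u R l))))"
      unfolding sign_mean_def using gB
      by (intro integrable_divide Bochner_Integration.integrable_sum integrable_const_bound[where B = 1]) auto
    show "AE R in M. sign_mean d (\<lambda>e. g (\<Sum>l<d. e l * (hadamard m j l * mat_vec d u R l))) \<le> 3 / d\<^sup>2"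
      using orth
    proof eventually_elim
      case (elim R)
      have "sign_mean d (\<lambda>e. g (\<Sum>l<d. e l * (hadamard m j l * mat_vec d u R l)))
          \<le> sign_mean d (\<lambda>e. 1 / d\<^sup>2 * (\<Sum>l<d. e l * (hadamard m j l * mat_vec d u R l)) ^ 4)"
        by (intro sign_mean_mono) (simp add: g_def)
      also have "\<dots> \<le> 1 / d\<^sup>2 * 3"
        unfolding sign_mean_cmult using mat_vec_norm[OF elim, of u] u
        by (intro mult_left_mono fourth_moment_hadamard) auto
      finally show ?case by simp
    qed
  qed auto
  finally show "(\<integral>R. mat_vec d u R j ^ 4 \<partial>M) \<le> 3 / (real d)\<^sup>2"
    by (simp add: prob_space)
qed

text \<open>For almost every R the vector R u has norm 1 and supplies admissible weights, so
  Lindeberg holds for that R and is then integrated.\<close>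

lemma haar_smooth:
  fixes m k :: nat and M :: "((nat \<times> nat) \<Rightarrow> real) measure"
  defines "d \<equiv> 2 ^ m :: nat"
  assumes M: "haar_orth d M" and k: "k < d" and u: "(\<Sum>l<d. (u l)\<^sup>2) = 1"
    and f: "fourth_order K f" and fm [measurable]: "f \<in> borel_measurable borel" and B: "\<And>x. \<bar>f x\<bar> \<le> B"
  shows "\<bar>(\<integral>R. f (sqrt d * mat_vec d u R k) \<partial>M) - gauss_mean 1 f\<bar> \<le> 12 * K / d"
proof -
  interpret prob_space M using M by (simp add: haar_orth_def)
  have [measurable_cong]: "sets M = sets (mat_space d)" using M by (simp add: haar_orth_def)
  note [measurable] = mat_vec_measurable
  have d: "real d > 0" by (simp add: d_def)
  have K: "0 \<le> K" using f by (rule fourth_order_nonneg)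
  define S where "S R = sign_mean d (\<lambda>e. f (\<Sum>l<d. e l * (hadamard m k l * mat_vec d u R l)))" for R
  have S: "integrable M S"
    unfolding S_def sign_mean_def using B
    by (intro integrable_divide Bochner_Integration.integrable_sum integrable_const_bound[where B = B]) auto
  have "(\<integral>R. f (sqrt d * mat_vec d u R k) \<partial>M) = (\<integral>R. S R \<partial>M)"
    unfolding d_def S_def by (rule haar_sign_mean) (use M k B in \<open>auto simp: d_def\<close>)
  then have "\<bar>(\<integral>R. f (sqrt d * mat_vec d u R k) \<partial>M) - gauss_mean 1 f\<bar> = \<bar>\<integral>R. S R - gauss_mean 1 f \<partial>M\<bar>"
    using S prob_space by simp
  also have "\<dots> \<le> (\<integral>R. \<bar>S R - gauss_mean 1 f\<bar> \<partial>M)"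
    by (rule integral_abs_bound)
  also have "\<dots> \<le> (\<integral>R. 4 * K * (\<Sum>j<d. mat_vec d u R j ^ 4) \<partial>M)"
  proof (rule integral_mono_AE)
    show "AE R in M. \<bar>S R - gauss_mean 1 f\<bar> \<le> 4 * K * (\<Sum>j<d. mat_vec d u R j ^ 4)"
      using M[unfolded haar_orth_def, THEN conjunct2, THEN conjunct2, THEN conjunct1]
    proof eventually_elim
      case (elim R)
      show ?case
        unfolding S_def by (rule lindeberg_hadamard[OF f fm B]) (use mat_vec_norm[OF elim, of u] u in simp)
    qed
  next
    show "integrable M (\<lambda>R. 4 * K * (\<Sum>j<d. mat_vec d u R j ^ 4))"
      using haar_fourth_moment(1)[of m M _ u] M u
      by (intro integrable_mult_right Bochner_Integration.integrable_sum) (auto simp: d_def)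
  qed (use S in auto)
  also have "\<dots> = 4 * K * (\<Sum>j<d. \<integral>R. mat_vec d u R j ^ 4 \<partial>M)"
    using haar_fourth_moment(1)[of m M _ u] M u by (simp add: d_def)
  also have "\<dots> \<le> 4 * K * (\<Sum>j<d. 3 / d\<^sup>2)"
    using K haar_fourth_moment(2)[of m M _ u] M u
    by (intro mult_left_mono sum_mono) (auto simp: d_def)
  also have "\<dots> = 12 * K / d"
    using d by (simp add: power2_eq_square)
  finally show ?thesis .
qed

subsection \<open>Constants and conclusion\<close>

text \<open>Machin's formula gives pi/4 = 4 arctan (1/5) - arctan (1/239) < 4/5.\<close>

lemma pi_less_16_5: "pi < 16 / 5"
proof -
  have "arctan (1 / 5) \<le> 1 / 5" by (rule arctan_le_self) simp
  moreover have "0 < arctan (1 / 239)" by simp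
  ultimately show ?thesis using machin by linarith
qed

lemma pi_ge_3: "3 \<le> pi"
proof -
  have "sin (pi / 6) \<le> pi / 6" by (rule sin_x_le_x) simp
  then show ?thesis by (simp add: sin_30)
qed

text \<open>5 * 0.47 + 1.05 = 3.4. Fifth and fourth powers clear the fractional exponents of the two
  summands.\<close>

lemma C_pos_ge: "C_pos \<ge> 34 / 10"
proof -
  have "47 / 100 \<le> 3 powr (4/5) / pi powr (7/5)"
  proof (rule power_le_imp_le_base)
    have "(3 powr (4/5) / pi powr (7/5)) ^ Suc 4 = 81 / pi ^ 7"
      by (simp add: power_divide powr_power del: power_Suc)
    also have "\<dots> \<ge> 81 / (16 / 5) ^ 7"
      using pi_less_16_5 by (intro divide_left_mono power_mono mult_pos_pos) auto
    finally show "(47 / 100) ^ Suc 4 \<le> (3 powr (4/5) / pi powr (7/5)) ^ Suc 4"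
      by (rule order.trans[rotated]) (simp add: eval_nat_numeral)
  qed simp
  moreover have "105 / 100 \<le> sqrt 2 / pi powr (1/4)"
  proof (rule power_le_imp_le_base)
    have "sqrt 2 ^ 4 = (4::real)" by (simp add: eval_nat_numeral)
    then have "(sqrt 2 / pi powr (1/4)) ^ Suc 3 = 4 / pi"
      by (simp add: power_divide powr_power del: power_Suc)
    also have "\<dots> \<ge> 4 / (16 / 5)"
      using pi_less_16_5 by (intro divide_left_mono) auto
    finally show "(105 / 100) ^ Suc 3 \<le> (sqrt 2 / pi powr (1/4)) ^ Suc 3"
      by (rule order.trans[rotated]) (simp add: eval_nat_numeral)
  qed simp
  moreover have "C_pos = 5 * (3 powr (4/5) / pi powr (7/5)) + sqrt 2 / pi powr (1/4)"
    by (simp add: C_pos_def)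
  moreover have "34 / 10 \<le> 5 * a + b" if "47 / 100 \<le> a" "105 / 100 \<le> b" for a b :: real
    using that by linarith
  ultimately show ?thesis by (simp only:)
qed

text \<open>With \<epsilon> = 5 q and q^5 = 1/D, both error terms are multiples of q: the first is
  24 * 35 / 5^4 = 168/125, the second at most 5 / 2.44, since 2.44^2 < 6 \<le> 2 pi. Their sum stays
  below 3.4.\<close>

lemma smoothing_width_bound:
  fixes D :: real
  assumes "0 < D"
  defines "\<epsilon> \<equiv> 5 * D powr (-1/5)"
  shows "2 * (12 * (35 / \<epsilon> ^ 4) / D) + \<epsilon> / sqrt (2 * pi) \<le> C_pos * D powr (-1/5)"
proof -
  define q where "q = D powr (-1/5)"
  have q: "q > 0" using assms(1) by (simp add: q_def)
  have \<epsilon>: "\<epsilon> = 5 * q" by (simp add: \<epsilon>_def q_def)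
  have "q ^ 5 = 1 / D"
    using assms(1) unfolding q_def by (subst powr_power) (simp_all add: powr_neg_one)
  then have "1 / (D * q ^ 4) = q"
    using q assms(1) by (simp add: field_simps eval_nat_numeral)
  moreover have "2 * (12 * (35 / \<epsilon> ^ 4) / D) = 168 / 125 * (1 / (D * q ^ 4))"
    by (simp add: \<epsilon> power_mult_distrib)
  ultimately have 1: "2 * (12 * (35 / \<epsilon> ^ 4) / D) = 168 / 125 * q"
    by (simp only:)
  have "61 / 25 \<le> sqrt (2 * pi)"
    using pi_ge_3 by (intro real_le_rsqrt) (simp add: power2_eq_square)
  then have 2: "5 * q / sqrt (2 * pi) \<le> 5 * q / (61 / 25)"
    using q by (intro divide_left_mono) auto
  have 3: "34 / 10 * q \<le> C_pos * q"
    using C_pos_ge q by (intro mult_right_mono) auto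
  have "2 * (12 * (35 / \<epsilon> ^ 4) / D) + \<epsilon> / sqrt (2 * pi) \<le> 168 / 125 * q + 5 * q / (61 / 25)"
    unfolding 1 using 2 by (simp only: \<epsilon> add_left_mono)
  also have "\<dots> \<le> 34 / 10 * q"
    using q by simp
  also note 3
  finally show ?thesis by (simp only: q_def)
qed

theorem mainTheorem2:
  fixes m :: nat and M :: "((nat \<times> nat) \<Rightarrow> real) measure"
  assumes "m \<ge> 1"
    and "haar_orth (2^m) M"
  shows "\<forall>u :: nat \<Rightarrow> real. (\<Sum>l<2^m. (u l)\<^sup>2) = 1 \<longrightarrow>
           (\<forall>k<2^m. kolmogorov_dist (T_cdf m u k) (X_cdf (2^m) M u k)
                      \<le> C_pos * real (2^m) powr (-1/5))"
proof (intro allI impI)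
  fix u :: "nat \<Rightarrow> real" and k :: nat
  assume u: "(\<Sum>l<2^m. (u l)\<^sup>2) = 1" and k: "k < 2 ^ m"
  define d :: nat where "d = 2 ^ m"
  have d: "real d > 0" by (simp add: d_def)
  interpret prob_space M using assms by (simp add: haar_orth_def)
  have [measurable_cong]: "sets M = sets (mat_space d)" using assms by (simp add: haar_orth_def d_def)
  note [measurable] = mat_vec_measurable
  have kd: "k < d" using k by (simp add: d_def)
  define \<epsilon> where "\<epsilon> = 5 * real d powr (-1/5)"
  have \<epsilon>: "\<epsilon> > 0" using d by (simp add: \<epsilon>_def)
  define \<eta> where "\<eta> = 12 * (35 / \<epsilon> ^ 4) / d"
  define E_T where "E_T f = sign_mean d (\<lambda>e2. sign_mean d (\<lambda>e1. f (sqrt d * T_coord m u k e1 e2)))"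
    for f :: "real \<Rightarrow> real"
  define E_X where "E_X f = (\<integral>R. f (sqrt d * mat_vec d u R k) \<partial>M)" for f :: "real \<Rightarrow> real"
  have E_T: "\<bar>E_T (fall r \<epsilon>) - gauss_mean 1 (fall r \<epsilon>)\<bar> \<le> \<eta>" for r
    unfolding E_T_def \<eta>_def d_def
    by (rule T_coord_smooth[OF fourth_order_fall[OF \<epsilon>] fall_measurable fall_abs u])
  have E_X: "\<bar>E_X (fall r \<epsilon>) - gauss_mean 1 (fall r \<epsilon>)\<bar> \<le> \<eta>" for r
    unfolding E_X_def \<eta>_def d_def
    by (rule haar_smooth[OF assms(2) k u fourth_order_fall[OF \<epsilon>] fall_measurable fall_abs])
  \<comment> \<open>Passes to the variables of unit variance scale, so the threshold becomes sqrt d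
    * t.\<close>
  have scale: "indicator {..t} y = (indicator {..sqrt d * t} (sqrt d * y) :: real)" for t y
    using d by (auto split: split_indicator)
  have T: "T_cdf m u k t = E_T (indicator {..sqrt d * t})" for t
    unfolding T_cdf_eq_sign_mean E_T_def d_def[symmetric] scale[symmetric] ..
  have X: "X_cdf d M u k t = E_X (indicator {..sqrt d * t})" for t
  proof -
    have "X_cdf d M u k t = measure M {R \<in> space M. mat_vec d u R k \<le> t}"
      by (simp add: X_cdf_def mat_vec_def)
    also have "\<dots> = (\<integral>R. indicator {R \<in> space M. mat_vec d u R k \<le> t} R \<partial>M)"
      by (auto intro!: arg_cong[where f = prob])
    also have "\<dots> = (\<integral>R. indicator {..t} (mat_vec d u R k) \<partial>M)"
      by (intro Bochner_Integration.integral_cong) (auto split: split_indicator)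
    finally show ?thesis
      unfolding E_X_def scale[symmetric] .
  qed
  have int: "integrable M (\<lambda>R. f (sqrt d * mat_vec d u R k))"
    if "f \<in> borel_measurable borel" "\<And>x. \<bar>f x\<bar> \<le> 1" for f :: "real \<Rightarrow> real"
    using that kd by (intro integrable_const_bound[where B = 1]) auto
  have E_T_mono: "E_T f \<le> E_T g" if "\<And>x. f x \<le> g x" for f g
    unfolding E_T_def using that by (intro sign_mean_mono) auto
  have E_X_mono: "E_X f \<le> E_X g"
    if "\<And>x. f x \<le> g x" "f \<in> borel_measurable borel" "g \<in> borel_measurable borel"
      "\<And>x. \<bar>f x\<bar> \<le> 1" "\<And>x. \<bar>g x\<bar> \<le> 1" for f g
    unfolding E_X_def using that by (intro integral_mono int) auto
  have "\<bar>T_cdf m u k t - X_cdf d M u k t\<bar> \<le> C_pos * real d powr (-1/5)" for t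
  proof -
    define s where "s = sqrt d * t"
    have ind: "indicator {..s} \<in> borel_measurable (borel :: real measure)" "\<bar>indicator {..s} x :: real\<bar> \<le> 1" for x
      by (auto split: split_indicator)
    \<comment> \<open>Bounding one CDF by the majorant and the other by the minorant costs \<eta>
      for each passage to the Gaussian, but the Gaussian gap between the two steps only
      once.\<close>
    have "T_cdf m u k t \<le> E_T (fall s \<epsilon>)" "E_T (fall (s - \<epsilon>) \<epsilon>) \<le> T_cdf m u k t"
      unfolding T s_def[symmetric] using fall_ge_indicator[OF \<epsilon>] fall_le_indicator[OF \<epsilon>]
      by (auto intro!: E_T_mono)
    moreover have "X_cdf d M u k t \<le> E_X (fall s \<epsilon>)" "E_X (fall (s - \<epsilon>) \<epsilon>) \<le> X_cdf d M u k t"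
      unfolding X s_def[symmetric] using fall_ge_indicator[OF \<epsilon>] fall_le_indicator[OF \<epsilon>] ind
      by (auto intro!: E_X_mono fall_abs)
    moreover have "2 * \<eta> + \<epsilon> / sqrt (2 * pi) \<le> C_pos * real d powr (-1/5)"
      unfolding \<eta>_def \<epsilon>_def by (rule smoothing_width_bound[OF d])
    ultimately show ?thesis
      using gauss_mean_fall_diff[OF \<epsilon>, of s] E_T[of s] E_T[of "s - \<epsilon>"] E_X[of s] E_X[of "s - \<epsilon>"]
      unfolding abs_le_iff by linarith
  qed
  then show "kolmogorov_dist (T_cdf m u k) (X_cdf (2^m) M u k) \<le> C_pos * real (2^m) powr (-1/5)"
    unfolding kolmogorov_dist_def d_def by (intro cSUP_least) auto
qed

end
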